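(* Let $h\in\mathbb{C}^{us}$ be the random hierarchically $(k_u,k_s)$-sparse vector, $y=Ah+z\in\mathbb{C}^m$ the noisy measurements and $h^\ast$ the output of HiHTP (or HiIHT), all as described in the context, let $\xi\ge 0$ be the energy threshold, and let $\tau=\tau(m)<\infty$ be the noise enhancement constant and $\mathbb{P}_{\overline{\mathrm{RIP}}}$ the RIP failure probability of the recovery guarantee described in the context. Let $P_{\mathrm{md}}(\xi)$ be the probability that a given active user is missed by the detector, and let $F(x):=\mathbb{P}(\|h_i\|^2\le x)$ be the cumulative distribution function of the energy of the block of an active user $i$. Then $$P_{\mathrm{md}}(\xi)\;\le\;\mathbb{P}_{\overline{\mathrm{RIP}}}\;+\;F(4\xi)\;+\;(4\tau^2)^{k_s}\,n^{-k_s}\,\mathrm{SNR}^{-k_s}\,B_1(m,k_s),$$ where $$B_1(m,k_s):=\sum_{j=0}^{m-1}\frac{\Gamma(k_s+j)}{\Gamma(k_s)\,j!}.$$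
   Context: All norms $\|\cdot\|$ are $\ell_2$-norms. $u,s,k_u,k_s,n,m$ are positive integers with $k_u\le u$, $k_s\le s$, $us\le n$, $m\le n$. Signal model. $h=[h_1^T\,\dots\,h_u^T]^T\in\mathbb{C}^{us}$ consists of $u$ blocks $h_i\in\mathbb{C}^s$, one per user. A vector is (hierarchically) $(k_u,k_s)$-sparse if at most $k_u$ blocks have non-vanishing entries and each of these blocks has at most $k_s$ non-zero entries. The set of active users is a uniformly random subset of the $u$ users of size $k_u$; for each active user $i$ the support of $h_i$ is a uniformly random subset of size $k_s$ of the $s$ positions; the non-zero entries are independent $\mathcal{CN}(0,1)$ (circularly symmetric complex Gaussian with unit variance); $h_i=0$ for inactive users. Measurements. $y=Ah+z$, where $A\in\mathbb{C}^{m\times us}$ is a random measurement matrix (in the system considered, a randomly subsampled normalized FFT matrix) and $z\sim\mathcal{CN}(0,\frac{\sigma^2}{n}I_m)$; $h$, $A$, $z$ are independent. $\mathrm{SNR}:=1/\sigma^2$. Algorithms. For $x\in\mathbb{C}^{us}$ let $L_{k_u,k_s}(x)$ be the support of a best $\ell_2$-approximation of $x$ by a $(k_u,k_s)$-sparse vector. Starting from $h^{(0)}=0$, iterate: $\mathcal{A}^{(t+1)}=L_{k_u,k_s}\big(h^{(t)}+A^H(y-Ah^{(t)})\big)$, and then (HiHTP) $h^{(t+1)}=\arg\min\{\|y-Ax\|:\operatorname{supp}(x)\subseteq\mathcal{A}^{(t+1)}\}$, or (HiIHT) $h^{(t+1)}$ is the restriction of $h^{(t)}+A^H(y-Ah^{(t)})$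 to $\mathcal{A}^{(t+1)}$ (zero elsewhere). When a stopping criterion is met, the last iterate is the output $h^\ast$, with blocks $h^\ast_i$. Recovery guarantee (assumed as known). $\mathbb{P}_{\overline{\mathrm{RIP}}}$ denotes the probability that $A$ fails to have the hierarchical restricted isometry property required for recovery; whenever $A$ has this property, the output satisfies $\|h^\ast-h\|\le\tau\|z\|$ for every $(k_u,k_s)$-sparse $h$ and every noise vector $z$, with a finite constant $\tau=\tau(m)$. In particular $\mathbb{P}(\|h^\ast-h\|>\epsilon)\le\mathbb{P}_{\overline{\mathrm{RIP}}}+\mathbb{P}(\tau\|z\|>\epsilon)$. User detection. User $i$ is declared active if and only if $\|h^\ast_i\|\ge\sqrt{\xi}$. An active user is missed if it is not declared active; by symmetry the probability $P_{\mathrm{md}}(\xi)$ of this event is the same for all active users. *)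

theory Defs
  imports "HOL-Probability.Probability"
begin

text \<open>
  Vectors in $C^{us}$ are indexed by pairs (user, position in the block of that user), so that
  $u$, $s$ and $m$ are the cardinalities of the index types \<open>'u\<close>, \<open>'s\<close>, \<open>'m\<close>.  The norm of
  \<open>complex ^ 'n\<close> is the l2-norm.
\<close>

type_synonym ('u, 's) signal = "complex ^ ('u \<times> 's)"
type_synonym ('u, 's, 'm) measurement_matrix = "complex ^ ('u \<times> 's) ^ 'm"

definition block :: "('u::finite, 's::finite) signal \<Rightarrow> 'u \<Rightarrow> complex ^ 's" where
  "block x i = (\<chi> j. x $ (i, j))"

definition supp :: "complex ^ 'k \<Rightarrow> 'k set" where
  "supp x = {p. x $ p \<noteq> 0}"

definition restrict_to :: "'k set \<Rightarrow> complex ^ 'k \<Rightarrow> complex ^ 'k" where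
  "restrict_to S x = (\<chi> p. if p \<in> S then x $ p else 0)"

definition conj_transpose :: "complex ^ 'n ^ 'm \<Rightarrow> complex ^ 'm ^ 'n" where
  "conj_transpose A = (\<chi> i j. cnj (A $ j $ i))"

definition hier_sparse :: "nat \<Rightarrow> nat \<Rightarrow> ('u::finite, 's::finite) signal \<Rightarrow> bool" where
  "hier_sparse k\<^sub>u k\<^sub>s x \<longleftrightarrow>
     card {i. block x i \<noteq> 0} \<le> k\<^sub>u \<and> (\<forall>i. card (supp (block x i)) \<le> k\<^sub>s)"


section \<open>Probabilistic model\<close>

text \<open>The law \<open>CN(0, v)\<close>: real and imaginary part are independent normal with variance \<open>v / 2\<close>.\<close>

definition complex_normal :: "real \<Rightarrow> complex measure" where
  "complex_normal v = density lborel (\<lambda>x. ennreal (exp (- (cmod x)\<^sup>2 / v) / (pi * v)))"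

text \<open>The law \<open>CN(0, v I)\<close> of a vector with independent entries.\<close>

definition complex_normal_vec :: "real \<Rightarrow> (complex ^ 'k::finite) measure" where
  "complex_normal_vec v = distr (\<Pi>\<^sub>M k\<in>UNIV. complex_normal v) borel (\<lambda>f. \<chi> k. f k)"

text \<open>
  Joint law of the set of active users and the signal.  Position sets and Gaussian values are
  drawn for all users and all positions, but they enter the signal only at the chosen positions
  of active users.
\<close>

definition signal_law ::
    "nat \<Rightarrow> nat \<Rightarrow> ('u::finite set \<times> ('u, 's::finite) signal) measure" where
  "signal_law k\<^sub>u k\<^sub>s =
     distr
       (measure_pmf (pmf_of_set {U :: 'u set. card U = k\<^sub>u})
         \<Otimes>\<^sub>M (\<Pi>\<^sub>M i\<in>(UNIV :: 'u set). measure_pmf (pmf_of_set {T :: 's set. card T = k\<^sub>s}))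
         \<Otimes>\<^sub>M complex_normal_vec 1)
       (count_space UNIV \<Otimes>\<^sub>M borel)
       (\<lambda>(U, S, g). (U, \<chi> p. if fst p \<in> U \<and> snd p \<in> S (fst p) then g $ p else 0))"

text \<open>
  Mutual independence of three random variables with values in different types, as independence
  of the generated sigma-algebras (\<open>indep_vars\<close> requires a common value type).
\<close>

definition indep_three ::
    "'a measure \<Rightarrow> 'b measure \<Rightarrow> ('a \<Rightarrow> 'b) \<Rightarrow> 'c measure \<Rightarrow> ('a \<Rightarrow> 'c)
      \<Rightarrow> 'd measure \<Rightarrow> ('a \<Rightarrow> 'd) \<Rightarrow> bool" where
  "indep_three M N\<^sub>1 X N\<^sub>2 Y N\<^sub>3 Z \<longleftrightarrow>
     prob_space.indep_sets M
       (\<lambda>k :: nat. [sets (vimage_algebra (space M) X N\<^sub>1),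
                    sets (vimage_algebra (space M) Y N\<^sub>2),
                    sets (vimage_algebra (space M) Z N\<^sub>3)] ! k)
       {0, 1, 2}"


section \<open>The algorithms\<close>

text \<open>
  Best approximations, and least-squares minimisers over a given support, need not be unique.
  Hence one iteration is a relation between successive iterates, leaving the tie-breaking open.
\<close>

definition best_hier_approx ::
    "nat \<Rightarrow> nat \<Rightarrow> ('u::finite, 's::finite) signal \<Rightarrow> ('u, 's) signal \<Rightarrow> bool" where
  "best_hier_approx k\<^sub>u k\<^sub>s x w \<longleftrightarrow>
     hier_sparse k\<^sub>u k\<^sub>s w \<and> (\<forall>v. hier_sparse k\<^sub>u k\<^sub>s v \<longrightarrow> norm (x - w) \<le> norm (x - v))"

definition best_supports ::
    "nat \<Rightarrow> nat \<Rightarrow> ('u::finite, 's::finite) signal \<Rightarrow> ('u \<times> 's) set set" where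
  "best_supports k\<^sub>u k\<^sub>s x = {supp w | w. best_hier_approx k\<^sub>u k\<^sub>s x w}"

definition gradient_step ::
    "('u::finite, 's::finite, 'm::finite) measurement_matrix \<Rightarrow> complex ^ 'm
      \<Rightarrow> ('u, 's) signal \<Rightarrow> ('u, 's) signal" where
  "gradient_step A y x = x + conj_transpose A *v (y - A *v x)"

definition HiHTP_step ::
    "nat \<Rightarrow> nat \<Rightarrow> ('u::finite, 's::finite, 'm::finite) measurement_matrix \<Rightarrow> complex ^ 'm
      \<Rightarrow> ('u, 's) signal \<Rightarrow> ('u, 's) signal \<Rightarrow> bool" where
  "HiHTP_step k\<^sub>u k\<^sub>s A y x x' \<longleftrightarrow>
     (\<exists>S \<in> best_supports k\<^sub>u k\<^sub>s (gradient_step A y x).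
        supp x' \<subseteq> S \<and> (\<forall>w. supp w \<subseteq> S \<longrightarrow> norm (y - A *v x') \<le> norm (y - A *v w)))"

definition HiIHT_step ::
    "nat \<Rightarrow> nat \<Rightarrow> ('u::finite, 's::finite, 'm::finite) measurement_matrix \<Rightarrow> complex ^ 'm
      \<Rightarrow> ('u, 's) signal \<Rightarrow> ('u, 's) signal \<Rightarrow> bool" where
  "HiIHT_step k\<^sub>u k\<^sub>s A y x x' \<longleftrightarrow>
     (\<exists>S \<in> best_supports k\<^sub>u k\<^sub>s (gradient_step A y x). x' = restrict_to S (gradient_step A y x))"

text \<open>
  \<open>x\<close> is the last iterate of a run from \<open>0\<close> that ends as soon as the stopping criterion, a
  condition on the data and all iterates computed so far, is met.
\<close>

definition algorithm_output ::
    "(('u::finite, 's::finite, 'm::finite) measurement_matrix \<Rightarrow> complex ^ 'm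
        \<Rightarrow> ('u, 's) signal \<Rightarrow> ('u, 's) signal \<Rightarrow> bool)
      \<Rightarrow> (('u, 's, 'm) measurement_matrix \<Rightarrow> complex ^ 'm \<Rightarrow> ('u, 's) signal list \<Rightarrow> bool)
      \<Rightarrow> ('u, 's, 'm) measurement_matrix \<Rightarrow> complex ^ 'm \<Rightarrow> ('u, 's) signal \<Rightarrow> bool" where
  "algorithm_output step stop A y x \<longleftrightarrow>
     (\<exists>it T. it 0 = 0 \<and> (\<forall>t<T. step A y (it t) (it (Suc t)))
        \<and> stop A y (map it [0..<Suc T]) \<and> (\<forall>t<T. \<not> stop A y (map it [0..<Suc t]))
        \<and> x = it T)"


section \<open>Recovery guarantee and user detection\<close>

definition HiRIP_const ::
    "nat \<Rightarrow> nat \<Rightarrow> ('u::finite, 's::finite, 'm::finite) measurement_matrix \<Rightarrow> real" where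
  "HiRIP_const p q A =
     Inf {\<delta>. 0 \<le> \<delta> \<and> (\<forall>x. hier_sparse p q x \<longrightarrow>
            (1 - \<delta>) * (norm x)\<^sup>2 \<le> (norm (A *v x))\<^sup>2 \<and>
            (norm (A *v x))\<^sup>2 \<le> (1 + \<delta>) * (norm x)\<^sup>2)}"

text \<open>
  Recovery theorems require the constant of some sparsity order \<open>(p, q)\<close>, a multiple of the
  sparsity of the signal, to lie below some threshold \<open>\<delta>\<close>; e.g. order \<open>(3k\<^sub>u, 2k\<^sub>s)\<close>.
\<close>

definition has_HiRIP ::
    "nat \<Rightarrow> nat \<Rightarrow> real \<Rightarrow> ('u::finite, 's::finite, 'm::finite) measurement_matrix \<Rightarrow> bool" where
  "has_HiRIP p q \<delta> A \<longleftrightarrow> HiRIP_const p q A < \<delta>"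

definition declared_active :: "real \<Rightarrow> ('u::finite, 's::finite) signal \<Rightarrow> 'u \<Rightarrow> bool" where
  "declared_active \<xi> x i \<longleftrightarrow> norm (block x i) \<ge> sqrt \<xi>"

text \<open>Probability that user \<open>i\<close> is missed, given that it is active.\<close>

definition P_md ::
    "'a measure \<Rightarrow> ('a \<Rightarrow> 'u::finite set) \<Rightarrow> ('a \<Rightarrow> ('u, 's::finite) signal)
      \<Rightarrow> 'u \<Rightarrow> real \<Rightarrow> real" where
  "P_md M act hstar i \<xi> = cond_prob M (\<lambda>\<omega>. \<not> declared_active \<xi> (hstar \<omega>) i) (\<lambda>\<omega>. i \<in> act \<omega>)"

text \<open>Distribution function of the block energy of user \<open>i\<close>, given that it is active.\<close>

definition energy_cdf ::
    "'a measure \<Rightarrow> ('a \<Rightarrow> 'u::finite set) \<Rightarrow> ('a \<Rightarrow> ('u, 's::finite) signal)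
      \<Rightarrow> 'u \<Rightarrow> real \<Rightarrow> real" where
  "energy_cdf M act h i x = cond_prob M (\<lambda>\<omega>. (norm (block (h \<omega>) i))\<^sup>2 \<le> x) (\<lambda>\<omega>. i \<in> act \<omega>)"

definition SNR :: "real \<Rightarrow> real" where
  "SNR \<sigma> = 1 / \<sigma>\<^sup>2"

definition B\<^sub>1 :: "nat \<Rightarrow> nat \<Rightarrow> real" where
  "B\<^sub>1 m k = (\<Sum>j = 0..m - 1. Gamma (real k + real j) / (Gamma (real k) * fact j))"

end

theory Submission
  imports Defs
begin

text \<open>
  If the recovery guarantee applies and an active user \<open>i\<close> is missed, then
  \<open>norm (block h i) < sqrt \<xi> + \<tau> * norm z\<close>, so either the block energy is at most \<open>4 * \<xi>\<close> or it is
  at most \<open>4 * \<tau>\<^sup>2 * (norm z)\<^sup>2\<close>.  The second event is estimated by conditioning on \<open>z\<close>: the energy of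
  an active block is a sum of \<open>k\<^sub>s\<close> independent \<open>Exp(1)\<close> variables and hence at most \<open>t\<close> with
  probability at most \<open>t ^ k\<^sub>s / k\<^sub>s!\<close>, while \<open>(norm z)\<^sup>2\<close> is Erlang distributed with known moments.  The
  moment of order \<open>k\<^sub>s\<close>, divided by \<open>k\<^sub>s!\<close>, is the closed form of \<open>B\<^sub>1\<close> given by the hockey-stick
  identity.
\<close>

section \<open>Borel measurability of vectors and their entries\<close>

lemma borel_measurable_cart_vec [measurable (raw)]:
  fixes f :: "'k::finite \<Rightarrow> 'a \<Rightarrow> 'b::euclidean_space"
  assumes "\<And>k. f k \<in> borel_measurable M"
  shows "(\<lambda>x. \<chi> k. f k x) \<in> borel_measurable M"
  unfolding borel_measurable_euclidean_space[where f="\<lambda>x. \<chi> k. f k x"]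
  using assms by (auto simp: Basis_vec_def inner_axis)

lemma borel_measurable_cart_nth [measurable (raw)]:
  fixes f :: "'a \<Rightarrow> 'b::euclidean_space ^ 'k::finite"
  assumes "f \<in> borel_measurable M"
  shows "(\<lambda>x. f x $ k) \<in> borel_measurable M"
  using measurable_compose[OF assms borel_measurable_continuous_onI[of "\<lambda>v. v $ k"]]
  by (simp add: continuous_on_component)

section \<open>Squared norms of complex Gaussian vectors\<close>

lemma power2_norm_vec: "(norm x)\<^sup>2 = (\<Sum>k\<in>UNIV. (norm (x $ k))\<^sup>2)"
  by (simp add: norm_vec_def L2_set_def sum_nonneg)

text \<open>A disc of radius \<open>sqrt a\<close> has area \<open>pi * a\<close>, so the image
  measure grows at the constant rate pi on the half-line. The half-lines \<open>{..a}\<close> are an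
  intersection-stable generator on which both measures are finite, so agreement there
  suffices.\<close>

lemma distr_lborel_cmod_power2:
  "distr lborel borel (\<lambda>x. (cmod x)\<^sup>2) = density lborel (\<lambda>x. ennreal pi * indicator {0..} x)"
    (is "?L = ?R")
proof (rule measure_eqI_generator_eq_countable[where \<Omega>=UNIV and E="range atMost"
      and A="range (\<lambda>n. {..real n})"])
  \<comment> \<open>The form \<open>pi * max 0 a\<close> also covers negative \<open>a\<close>,
    where both measures vanish.\<close>
  have eq: "emeasure ?L {..a} = ennreal (pi * max 0 a)" "emeasure ?R {..a} = ennreal (pi * max 0 a)" for a
  proof -
    have "emeasure ?L {..a} = emeasure lborel {x. (cmod x)\<^sup>2 \<le> a}"
      by (subst emeasure_distr) (auto intro!: arg_cong2[where f=emeasure])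
    also have "\<dots> = ennreal (pi * max 0 a)"
    proof (cases "a \<ge> 0")
      case True
      have "{x. (cmod x)\<^sup>2 \<le> a} = cball 0 (sqrt a)"
        using True by (auto simp: real_le_rsqrt sqrt_ge_absD)
      then show ?thesis
        using True by (simp add: emeasure_cball unit_ball_vol_2)
    next
      case False
      then have "{x. (cmod x)\<^sup>2 \<le> a} = {}"
        by (auto simp: not_le intro: less_le_trans)
      then show ?thesis
        using False by (simp only: ) (simp add: max_def)
    qed
    finally show "emeasure ?L {..a} = ennreal (pi * max 0 a)" .
    have "emeasure ?R {..a} = (\<integral>\<^sup>+x. ennreal pi * indicator {0..a} x \<partial>lborel)"
      by (subst emeasure_density) (auto intro!: nn_integral_cong split: split_indicator)
    also have "\<dots> = ennreal pi * emeasure lborel {0..a}"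
      by (simp add: nn_integral_cmult_indicator)
    also have "\<dots> = ennreal (pi * max 0 a)"
      by (auto simp: max_def ennreal_mult' emeasure_lborel_Icc_eq)
    finally show "emeasure ?R {..a} = ennreal (pi * max 0 a)" .
  qed
  show "emeasure ?L X = emeasure ?R X" if "X \<in> range atMost" for X
    using that eq by auto
  show "emeasure ?L X \<noteq> \<infinity>" if "X \<in> range (\<lambda>n. {..real n})" for X
    using that eq by auto
  show "Int_stable (range (atMost :: real \<Rightarrow> _))"
    by (auto simp: Int_stable_def)
  show "sets ?L = sigma_sets UNIV (range atMost)" "sets ?R = sigma_sets UNIV (range atMost)"
    by (simp_all add: borel_eq_atMost)
  show "(\<Union>(range (\<lambda>n. {..real n}))) = UNIV"
    by (auto intro: real_arch_simple)
qed auto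

text \<open>The Gaussian density depends on \<open>x\<close> only through
  \<open>(cmod x)\<^sup>2\<close>, so it can be carried through the image measure. The pi from the
  area of discs cancels the pi of the normalisation and leaves an exponential density.\<close>

lemma distr_complex_normal_cmod_power2:
  assumes "0 < v"
  shows "distr (complex_normal v) borel (\<lambda>x. (cmod x)\<^sup>2) = density lborel (exponential_density (1 / v))"
proof -
  have "distr (complex_normal v) borel (\<lambda>x. (cmod x)\<^sup>2)
      = density (distr lborel borel (\<lambda>x. (cmod x)\<^sup>2)) (\<lambda>t. ennreal (exp (- t / v) / (pi * v)))"
    unfolding complex_normal_def by (subst density_distr) auto
  also have "\<dots> = density lborel (\<lambda>t. ennreal pi * indicator {0..} t * ennreal (exp (- t / v) / (pi * v)))"
    unfolding distr_lborel_cmod_power2 by (subst density_density_eq) auto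
  also have "\<dots> = density lborel (exponential_density (1 / v))"
    using assms by (intro density_cong AE_I2)
      (auto simp: exponential_density_def ennreal_mult[symmetric] split: split_indicator)
  finally show ?thesis .
qed

lemma sets_complex_normal [measurable_cong, simp]: "sets (complex_normal v) = sets borel"
  by (simp add: complex_normal_def)

lemma space_complex_normal [simp]: "space (complex_normal v) = UNIV"
  by (simp add: complex_normal_def)

lemma sets_complex_normal_vec [measurable_cong, simp]: "sets (complex_normal_vec v) = sets borel"
  by (simp add: complex_normal_vec_def)

lemma space_complex_normal_vec [simp]: "space (complex_normal_vec v) = UNIV"
  by (simp add: complex_normal_vec_def)

text \<open>The total mass is read off an image measure: the law of the squared modulus is
  exponential and hence has mass one.\<close>

lemma prob_space_complex_normal:
  assumes "0 < v"
  shows "prob_space (complex_normal v)"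
proof (rule prob_space_distrD)
  show "(\<lambda>x. (cmod x)\<^sup>2) \<in> complex_normal v \<rightarrow>\<^sub>M borel" by measurable
  show "prob_space (distr (complex_normal v) borel (\<lambda>x. (cmod x)\<^sup>2))"
    using assms by (simp add: distr_complex_normal_cmod_power2 prob_space_exponential_density)
qed

lemma measurable_vec_PiM [measurable]:
  "(\<lambda>f. \<chi> k. f k) \<in> (\<Pi>\<^sub>M k\<in>UNIV. complex_normal v) \<rightarrow>\<^sub>M (borel :: (complex ^ 'k::finite) measure)"
  by (rule borel_measurable_cart_vec) measurable

lemma prob_space_complex_normal_vec:
  assumes "0 < v"
  shows "prob_space (complex_normal_vec v :: (complex ^ 'k::finite) measure)"
proof -
  interpret prob_space "\<Pi>\<^sub>M k\<in>(UNIV :: 'k set). complex_normal v"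
    by (intro prob_space_PiM prob_space_complex_normal assms)
  show ?thesis
    unfolding complex_normal_vec_def by (rule prob_space_distr) measurable
qed

text \<open>Independent exponential variables of equal rate add up to an Erlang variable, and the
  index of \<open>erlang_density\<close> is one less than the number of summands. A general
  \<open>T\<close> serves two purposes: the support of one block of the signal, and all coordinates
  of the noise.\<close>

lemma distributed_sum_cmod_power2:
  fixes T :: "'k::finite set"
  assumes "0 < v" "T \<noteq> {}"
  shows "distributed (complex_normal_vec v) lborel (\<lambda>g. \<Sum>k\<in>T. (cmod (g $ k))\<^sup>2)
      (erlang_density (card T - 1) (1 / v))"
proof -
  let ?P = "\<Pi>\<^sub>M k\<in>(UNIV :: 'k set). complex_normal v"
  interpret P: prob_space ?P
    by (intro prob_space_PiM prob_space_complex_normal assms)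
  have coord: "distr ?P borel (\<lambda>f. f k) = complex_normal v" for k
    using distr_PiM_component[of UNIV "\<lambda>_. complex_normal v" k] assms
    by (simp add: prob_space_complex_normal cong: distr_cong)
  \<comment> \<open>The coordinates are independent because their joint law is the product of their
    marginals: over the full index set the joint map is the identity on \<open>?P\<close>.\<close>
  have "P.indep_vars (\<lambda>_. borel) (\<lambda>k f. f k) UNIV"
  proof (subst P.indep_vars_iff_distr_eq_PiM)
    show "distr ?P (\<Pi>\<^sub>M i\<in>UNIV. borel) (\<lambda>x. \<lambda>i\<in>UNIV. x i)
        = (\<Pi>\<^sub>M i\<in>UNIV. distr ?P borel (\<lambda>f. f i))"
      unfolding coord
      by (subst distr_cong[of _ ?P _ ?P _ "\<lambda>x. x"]) (auto intro!: sets_PiM_cong)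
  qed auto
  then have "P.indep_vars (\<lambda>_. borel) (\<lambda>k f. f k) T"
    by (rule P.indep_vars_subset) auto
  then have indep: "P.indep_vars (\<lambda>_. borel) (\<lambda>k f. (cmod (f k))\<^sup>2) T"
    by (rule P.indep_vars_compose2) auto
  have "distributed ?P lborel (\<lambda>f. (cmod (f k))\<^sup>2) (exponential_density (1 / v))" for k
  proof -
    have "distr ?P lborel (\<lambda>f. (cmod (f k))\<^sup>2) = distr (distr ?P borel (\<lambda>f. f k)) borel (\<lambda>x. (cmod x)\<^sup>2)"
      by (subst distr_distr) (auto simp: comp_def cong: distr_cong)
    then show ?thesis
      unfolding coord distributed_def
      using assms by (simp add: distr_complex_normal_cmod_power2)
  qed
  then have D: "distributed ?P lborel (\<lambda>f. \<Sum>k\<in>T. (cmod (f k))\<^sup>2) (erlang_density (card T - 1) (1 / v))"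
    using assms indep by (intro P.exponential_distributed_sum) auto
  have "distr (complex_normal_vec v) lborel (\<lambda>g. \<Sum>k\<in>T. (cmod (g $ k))\<^sup>2)
      = distr ?P lborel (\<lambda>f. \<Sum>k\<in>T. (cmod (f k))\<^sup>2)"
    unfolding complex_normal_vec_def by (subst distr_distr) (auto simp: comp_def)
  then show ?thesis
    using D by (simp add: distributed_def)
qed

section \<open>Erlang distribution near zero and closed form of \<open>B\<^sub>1\<close>\<close>

lemma erlang_CDF_le:
  assumes "0 \<le> t"
  shows "erlang_CDF k 1 t \<le> t ^ Suc k / fact (Suc k)"
proof -
  \<comment> \<open>\<open>erlang_CDF k 1 t\<close> is \<open>exp (- t)\<close> times the remainder
    of the exponential series after \<open>k + 1\<close> terms. In Lagrange form this remainder
    contains \<open>exp s\<close> with \<open>s \<le> t\<close>, and the resulting factor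
    \<open>exp (s - t)\<close> is at most 1.\<close>
  obtain s where s: "\<bar>s\<bar> \<le> \<bar>t\<bar>"
    "exp t = (\<Sum>m<Suc k. t ^ m / fact m) + exp s / fact (Suc k) * t ^ Suc k"
    using Maclaurin_exp_le by blast
  have "erlang_CDF k 1 t = exp (- t) * (exp t - (\<Sum>m<Suc k. t ^ m / fact m))"
    using assms by (simp add: erlang_CDF_def right_diff_distrib exp_minus_inverse sum_distrib_left
        sum_divide_distrib lessThan_Suc_atMost mult.commute exp_add[symmetric] del: sum.lessThan_Suc)
  also have "\<dots> = exp (s - t) * (t ^ Suc k / fact (Suc k))"
    by (subst s(2)) (simp add: exp_diff exp_minus divide_inverse ac_simps del: fact_Suc power_Suc)
  also have "\<dots> \<le> 1 * (t ^ Suc k / fact (Suc k))"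
    using s(1) assms by (intro mult_right_mono) auto
  finally show ?thesis by simp
qed

text \<open>The Gamma quotients are the binomial coefficients \<open>(k - 1 + j) choose j\<close>,
  whose sum over \<open>j \<le> m - 1\<close> is a single binomial coefficient. The factorial form
  matches the Erlang moment of order \<open>k\<close> divided by \<open>fact k\<close>.\<close>

lemma B\<^sub>1_eq:
  assumes "0 < m" "0 < k"
  shows "B\<^sub>1 m k = fact (m - 1 + k) / (fact (m - 1) * fact k)"
proof -
  have "B\<^sub>1 m k = (\<Sum>j\<le>m - 1. real ((k - 1 + j) choose j))"
    unfolding B\<^sub>1_def
  proof (intro sum.cong)
    fix j
    have "Gamma (real k + real j) = fact (k - 1 + j)" "Gamma (real k) = fact (k - 1)"
      using Gamma_fact[of "k - 1 + j", where 'a=real] Gamma_fact[of "k - 1", where 'a=real] assms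
      by (simp_all add: of_nat_diff)
    then show "Gamma (real k + real j) / (Gamma (real k) * fact j) = real ((k - 1 + j) choose j)"
      by (simp add: binomial_fact)
  qed auto
  also have "\<dots> = real (\<Sum>j\<le>m - 1. (k - 1 + j) choose j)"
    by simp
  also have "\<dots> = real ((m - 1 + k) choose (m - 1))"
    unfolding sum_choose_lower using assms by (cases k; cases m) (simp_all add: add.commute)
  also have "\<dots> = fact (m - 1 + k) / (fact (m - 1) * fact k)"
    by (simp add: binomial_fact)
  finally show ?thesis .
qed

section \<open>Measurability of sparsity and of the restricted isometry property\<close>

lemma power2_norm_block: "(norm (block x i))\<^sup>2 = (\<Sum>j\<in>UNIV. (cmod (x $ (i, j)))\<^sup>2)"
  by (simp add: block_def power2_norm_vec)

lemma borel_measurable_power2_norm_block [measurable]: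
  "(\<lambda>x. (norm (block x i))\<^sup>2) \<in> borel_measurable borel"
  unfolding power2_norm_block by measurable

text \<open>Cardinalities of sets depending on \<open>x\<close> are replaced by bounded quantifiers
  over finitely many fixed sets \<open>V\<close> and \<open>T\<close>, with only coordinate
  equations inside. In this form measurability follows from closure under finite logical
  operations.\<close>

lemma hier_sparse_iff:
  "hier_sparse k\<^sub>u k\<^sub>s x \<longleftrightarrow>
    (\<exists>V\<in>{V. card V \<le> k\<^sub>u}. \<forall>i\<in>-V. \<forall>j\<in>UNIV. x $ (i, j) = 0) \<and>
    (\<forall>i\<in>UNIV. \<exists>T\<in>{T. card T \<le> k\<^sub>s}. \<forall>j\<in>-T. x $ (i, j) = 0)" (is "?L \<longleftrightarrow> ?U \<and> ?S")
proof -
  have "card {i. block x i \<noteq> 0} \<le> k\<^sub>u \<longleftrightarrow> ?U"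
  proof
    assume "card {i. block x i \<noteq> 0} \<le> k\<^sub>u"
    then show ?U
      by (intro bexI[of _ "{i. block x i \<noteq> 0}"]) (auto simp: block_def vec_eq_iff)
  next
    assume ?U
    then obtain V where V: "card V \<le> k\<^sub>u" "\<forall>i\<in>-V. \<forall>j. x $ (i, j) = 0" by auto
    then have "{i. block x i \<noteq> 0} \<subseteq> V" by (auto simp: block_def vec_eq_iff)
    then show "card {i. block x i \<noteq> 0} \<le> k\<^sub>u"
      using V(1) card_mono[of V] by (meson finite le_trans)
  qed
  moreover have "card (supp (block x i)) \<le> k\<^sub>s \<longleftrightarrow> (\<exists>T\<in>{T. card T \<le> k\<^sub>s}. \<forall>j\<in>-T. x $ (i, j) = 0)" for i
  proof
    assume "card (supp (block x i)) \<le> k\<^sub>s"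
    then show "\<exists>T\<in>{T. card T \<le> k\<^sub>s}. \<forall>j\<in>-T. x $ (i, j) = 0"
      by (intro bexI[of _ "supp (block x i)"]) (auto simp: block_def supp_def)
  next
    assume "\<exists>T\<in>{T. card T \<le> k\<^sub>s}. \<forall>j\<in>-T. x $ (i, j) = 0"
    then obtain T where T: "card T \<le> k\<^sub>s" "\<forall>j\<in>-T. x $ (i, j) = 0" by auto
    then have "supp (block x i) \<subseteq> T" by (auto simp: block_def supp_def)
    then show "card (supp (block x i)) \<le> k\<^sub>s"
      using T(1) card_mono[of T] by (meson finite le_trans)
  qed
  ultimately show ?thesis
    unfolding hier_sparse_def by simp
qed

lemma pred_hier_sparse [measurable]: "Measurable.pred borel (hier_sparse k\<^sub>u k\<^sub>s)"
  unfolding hier_sparse_iff[abs_def]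
  by (intro pred_intros_logic pred_intros_finite) (simp_all, measurable)

text \<open>The isometry condition quantifies over uncountably many signals. For a fixed constant
  \<open>c\<close> it is an intersection of closed conditions on the matrix, hence closed. It is
  monotone in \<open>c\<close>, so the infimum lies below \<delta> iff some rational constant below
  \<delta> is admissible, which gives a countable union of closed sets.\<close>

lemma pred_has_HiRIP [measurable]:
  "Measurable.pred borel (has_HiRIP p q \<delta> :: ('u::finite, 's::finite, 'm::finite) measurement_matrix \<Rightarrow> bool)"
proof -
  define good :: "real \<Rightarrow> ('u, 's, 'm) measurement_matrix \<Rightarrow> bool" where
    "good c A \<longleftrightarrow> (\<forall>x. hier_sparse p q x \<longrightarrow>
        (1 - c) * (norm x)\<^sup>2 \<le> (norm (A *v x))\<^sup>2 \<and> (norm (A *v x))\<^sup>2 \<le> (1 + c) * (norm x)\<^sup>2)" for c A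
  have const: "HiRIP_const p q A = Inf {c. 0 \<le> c \<and> good c A}" for A
    unfolding HiRIP_const_def good_def ..
  have mono: "good d A" if "good c A" "c \<le> d" for c d A
    unfolding good_def
  proof (intro allI impI)
    fix x :: "('u, 's) signal" assume "hier_sparse p q x"
    then have "(1 - c) * (norm x)\<^sup>2 \<le> (norm (A *v x))\<^sup>2" "(norm (A *v x))\<^sup>2 \<le> (1 + c) * (norm x)\<^sup>2"
      using that by (auto simp: good_def)
    moreover have "(1 - d) * (norm x)\<^sup>2 \<le> (1 - c) * (norm x)\<^sup>2" "(1 + c) * (norm x)\<^sup>2 \<le> (1 + d) * (norm x)\<^sup>2"
      using that by (auto intro!: mult_right_mono)
    ultimately show "(1 - d) * (norm x)\<^sup>2 \<le> (norm (A *v x))\<^sup>2 \<and> (norm (A *v x))\<^sup>2 \<le> (1 + d) * (norm x)\<^sup>2"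
      by linarith
  qed
  \<comment> \<open>This makes the set under the infimum nonempty. With \<open>K\<close> a bound for
    the operator norm, \<open>K\<^sup>2\<close> takes care of the upper inequality, and the 1 in the
    maximum makes the left side of the lower inequality nonpositive.\<close>
  have ex: "\<exists>c\<ge>0. good c A" for A
  proof -
    obtain K where K: "\<And>x. norm (A *v x) \<le> norm x * K"
      using bounded_linear.bounded[OF matrix_vector_mul_bounded_linear[of A]] by blast
    have "good (max 1 (K\<^sup>2)) A"
      unfolding good_def
    proof (intro allI impI conjI)
      fix x :: "('u, 's) signal"
      have "(1 - max 1 (K\<^sup>2)) * (norm x)\<^sup>2 \<le> 0"
        by (intro mult_nonpos_nonneg) auto
      then show "(1 - max 1 (K\<^sup>2)) * (norm x)\<^sup>2 \<le> (norm (A *v x))\<^sup>2"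
        by (rule order_trans) simp
      have "(norm (A *v x))\<^sup>2 \<le> (norm x * K)\<^sup>2"
        using K by (intro power_mono) auto
      also have "\<dots> = K\<^sup>2 * (norm x)\<^sup>2"
        by (simp add: power_mult_distrib)
      also have "\<dots> \<le> (1 + max 1 (K\<^sup>2)) * (norm x)\<^sup>2"
        by (intro mult_right_mono) auto
      finally show "(norm (A *v x))\<^sup>2 \<le> (1 + max 1 (K\<^sup>2)) * (norm x)\<^sup>2" .
    qed
    then show ?thesis by (intro exI[of _ "max 1 (K\<^sup>2)"]) auto
  qed
  have eq: "has_HiRIP p q \<delta> = (\<lambda>A. \<exists>r::rat. 0 \<le> r \<and> of_rat r < \<delta> \<and> good (of_rat r) A)"
  proof
    fix A
    have "has_HiRIP p q \<delta> A \<longleftrightarrow> (\<exists>c\<in>{c. 0 \<le> c \<and> good c A}. c < \<delta>)"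
      unfolding has_HiRIP_def const using ex[of A]
      by (intro cInf_less_iff) (auto intro!: bdd_belowI[of _ 0])
    also have "\<dots> \<longleftrightarrow> (\<exists>r::rat. 0 \<le> r \<and> of_rat r < \<delta> \<and> good (of_rat r) A)"
    proof
      assume "\<exists>c\<in>{c. 0 \<le> c \<and> good c A}. c < \<delta>"
      then obtain c where c: "0 \<le> c" "good c A" "c < \<delta>" by auto
      obtain r :: rat where r: "c < of_rat r" "of_rat r < \<delta>"
        using of_rat_dense[OF c(3)] by auto
      with c(1) have "0 \<le> (of_rat r :: real)" by linarith
      then show "\<exists>r::rat. 0 \<le> r \<and> of_rat r < \<delta> \<and> good (of_rat r) A"
        using c r mono[of c A "of_rat r"] by (intro exI[of _ r]) auto
    next
      assume "\<exists>r::rat. 0 \<le> r \<and> of_rat r < \<delta> \<and> good (of_rat r) A"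
      then obtain r :: rat where "0 \<le> r" "of_rat r < \<delta>" "good (of_rat r) A" by auto
      then show "\<exists>c\<in>{c. 0 \<le> c \<and> good c A}. c < \<delta>"
        by (intro bexI[of _ "of_rat r"]) auto
    qed
    finally show "has_HiRIP p q \<delta> A \<longleftrightarrow> (\<exists>r::rat. 0 \<le> r \<and> of_rat r < \<delta> \<and> good (of_rat r) A)" .
  qed
  have "closed {A. good c A}" for c
  proof -
    have cont: "continuous_on UNIV (\<lambda>A :: ('u, 's, 'm) measurement_matrix. (norm (A *v x))\<^sup>2)" for x
      unfolding matrix_vector_mult_def by (intro continuous_intros)
    have "{A. good c A} = (\<Inter>x\<in>{x. hier_sparse p q x}.
        {A. (1 - c) * (norm x)\<^sup>2 \<le> (norm (A *v x))\<^sup>2} \<inter> {A. (norm (A *v x))\<^sup>2 \<le> (1 + c) * (norm x)\<^sup>2})"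
      by (auto simp: good_def)
    also have "closed \<dots>"
      by (intro closed_INT ballI closed_Int closed_Collect_le cont continuous_on_const)
    finally show ?thesis .
  qed
  then have [measurable]: "Measurable.pred borel (good c)" for c
    by (simp add: pred_def borel_closed)
  show ?thesis
    unfolding eq by measurable
qed

section \<open>The signal law: sparsity and small block energy\<close>

lemma measurable_signal:
  "(\<lambda>(U, S, g). (U, \<chi> p. if fst p \<in> U \<and> snd p \<in> S (fst p) then g $ p else 0))
    \<in> measure_pmf P \<Otimes>\<^sub>M (\<Pi>\<^sub>M i\<in>(UNIV :: 'u::finite set). measure_pmf (Q i)) \<Otimes>\<^sub>M complex_normal_vec v
      \<rightarrow>\<^sub>M count_space UNIV \<Otimes>\<^sub>M (borel :: ('u, 's::finite) signal measure)"
proof -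
  let ?N = "measure_pmf P \<Otimes>\<^sub>M (\<Pi>\<^sub>M i\<in>(UNIV :: 'u set). measure_pmf (Q i)) \<Otimes>\<^sub>M
    (complex_normal_vec v :: ('u, 's) signal measure)"
  \<comment> \<open>The case distinction in the entries is measurable once the two membership events
    are. Each of them depends on one discrete component only, where every predicate is
    measurable.\<close>
  have [measurable]: "Measurable.pred ?N (\<lambda>w. i \<in> fst w)" for i
    by (rule measurable_compose[OF measurable_fst]) simp
  have [measurable]: "Measurable.pred ?N (\<lambda>w. j \<in> fst (snd w) i)" for i j
    by (rule measurable_compose[OF measurable_compose[OF measurable_compose[OF measurable_snd measurable_fst]
            measurable_component_singleton[of i]]]) simp_all
  have [measurable]: "fst \<in> ?N \<rightarrow>\<^sub>M count_space UNIV"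
    by (rule measurable_compose[OF measurable_fst, where g="\<lambda>x. x", simplified]) simp
  show ?thesis
    unfolding case_prod_beta by measurable
qed

text \<open>Both facts come from the same threefold product of active set, position sets and
  Gaussian values, integrated in this order. Once the sets are fixed, the energy of an active block
  is a sum of \<open>k\<^sub>s\<close> squared Gaussian moduli, and its Erlang bound is the same for
  all choices of sets. The second fact keeps the probability of activity as a factor, the
  unnormalised form of a conditional bound.\<close>

lemma
  assumes "0 < k\<^sub>u" "k\<^sub>u \<le> CARD('u::finite)" "0 < k\<^sub>s" "k\<^sub>s \<le> CARD('s::finite)"
  shows AE_signal_law_hier_sparse:
      "AE p in (signal_law k\<^sub>u k\<^sub>s :: ('u set \<times> ('u, 's) signal) measure). hier_sparse k\<^sub>u k\<^sub>s (snd p)"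
    and signal_law_block_energy_le:
      "0 \<le> t \<Longrightarrow> emeasure (signal_law k\<^sub>u k\<^sub>s) {p :: 'u set \<times> ('u, 's) signal. i \<in> fst p \<and> (norm (block (snd p) i))\<^sup>2 \<le> t}
        \<le> emeasure (signal_law k\<^sub>u k\<^sub>s) {p :: 'u set \<times> ('u, 's) signal. i \<in> fst p} * ennreal (t ^ k\<^sub>s / fact k\<^sub>s)"
proof -
  define P where "P = measure_pmf (pmf_of_set {U :: 'u set. card U = k\<^sub>u})"
  define Q where "Q = (\<Pi>\<^sub>M i\<in>(UNIV :: 'u set). measure_pmf (pmf_of_set {T :: 's set. card T = k\<^sub>s}))"
  define R where "R = (complex_normal_vec 1 :: ('u, 's) signal measure)"
  define \<Phi> :: "'u set \<times> ('u \<Rightarrow> 's set) \<times> ('u, 's) signal \<Rightarrow> 'u set \<times> ('u, 's) signal" where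
    "\<Phi> = (\<lambda>(U, S, g). (U, \<chi> p. if fst p \<in> U \<and> snd p \<in> S (fst p) then g $ p else 0))"
  have \<Phi> [measurable]: "\<Phi> \<in> P \<Otimes>\<^sub>M Q \<Otimes>\<^sub>M R \<rightarrow>\<^sub>M count_space UNIV \<Otimes>\<^sub>M borel"
    unfolding \<Phi>_def P_def Q_def R_def by (rule measurable_signal)
  have law: "signal_law k\<^sub>u k\<^sub>s = distr (P \<Otimes>\<^sub>M Q \<Otimes>\<^sub>M R) (count_space UNIV \<Otimes>\<^sub>M borel) \<Phi>"
    unfolding signal_law_def \<Phi>_def P_def Q_def R_def ..
  interpret P: prob_space P
    unfolding P_def by (rule prob_space_measure_pmf)
  interpret Q: prob_space Q
    unfolding Q_def by (intro prob_space_PiM prob_space_measure_pmf)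
  interpret R: prob_space R
    unfolding R_def by (rule prob_space_complex_normal_vec) simp
  interpret QR: pair_prob_space Q R ..
  interpret PQR: pair_prob_space P "Q \<Otimes>\<^sub>M R" ..
  have space: "space P = UNIV" "space Q = UNIV" "space R = UNIV"
    by (simp_all add: P_def Q_def R_def space_PiM)

  \<comment> \<open>\<open>pmf_of_set\<close> has the given set as its support only if that set is
    finite and nonempty; the bounds on \<open>k\<^sub>u\<close> and \<open>k\<^sub>s\<close> ensure
    the latter.\<close>
  have "{U :: 'u set. card U = k\<^sub>u} \<noteq> {}" "{T :: 's set. card T = k\<^sub>s} \<noteq> {}"
    using assms by (metis (mono_tags) ex_card empty_Collect_eq)+
  then have set_pmf: "set_pmf (pmf_of_set {U :: 'u set. card U = k\<^sub>u}) = {U. card U = k\<^sub>u}"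
    "set_pmf (pmf_of_set {T :: 's set. card T = k\<^sub>s}) = {T. card T = k\<^sub>s}"
    by (auto intro!: set_pmf_of_set)
  have AE_P: "AE U in P. card U = k\<^sub>u"
    unfolding P_def by (simp add: AE_measure_pmf_iff set_pmf)
  have "AE S in Q. card (S i) = k\<^sub>s" for i
    unfolding Q_def
    by (rule AE_PiM_component) (simp_all add: prob_space_measure_pmf AE_measure_pmf_iff set_pmf)
  then have AE_Q: "AE S in Q. \<forall>i. card (S i) = k\<^sub>s"
    by (simp add: AE_all_countable AE_finite_all)

  have hier: "{p \<in> space (count_space UNIV \<Otimes>\<^sub>M borel). hier_sparse k\<^sub>u k\<^sub>s (snd p)}
      \<in> sets (count_space UNIV \<Otimes>\<^sub>M borel)"
    by measurable
  \<comment> \<open>The drawn sets themselves witness \<open>hier_sparse_iff\<close>. Gaussian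
    values may vanish, so the actual supports may be smaller.\<close>
  have sparse: "hier_sparse k\<^sub>u k\<^sub>s (snd (\<Phi> (U, S, g)))" if "card U = k\<^sub>u" "\<forall>i. card (S i) = k\<^sub>s" for U S g
    unfolding hier_sparse_iff using that
    by (auto simp: \<Phi>_def intro!: exI[of _ U] exI[of _ "S _"])
  have "AE w in P \<Otimes>\<^sub>M Q \<Otimes>\<^sub>M R. hier_sparse k\<^sub>u k\<^sub>s (snd (\<Phi> w))"
  proof (rule PQR.AE_pair_measure)
    show "{w \<in> space (P \<Otimes>\<^sub>M Q \<Otimes>\<^sub>M R). hier_sparse k\<^sub>u k\<^sub>s (snd (\<Phi> w))} \<in> sets (P \<Otimes>\<^sub>M Q \<Otimes>\<^sub>M R)"
      by measurable
    show "AE U in P. AE w in Q \<Otimes>\<^sub>M R. hier_sparse k\<^sub>u k\<^sub>s (snd (\<Phi> (U, w)))"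
      using AE_P
    proof eventually_elim
      case (elim U)
      show ?case
      proof (rule QR.AE_pair_measure)
        have [measurable]: "(\<lambda>w. \<Phi> (U, w)) \<in> Q \<Otimes>\<^sub>M R \<rightarrow>\<^sub>M count_space UNIV \<Otimes>\<^sub>M borel"
          by (rule measurable_Pair2[OF \<Phi>]) (simp add: space)
        show "{w \<in> space (Q \<Otimes>\<^sub>M R). hier_sparse k\<^sub>u k\<^sub>s (snd (\<Phi> (U, w)))} \<in> sets (Q \<Otimes>\<^sub>M R)"
          by measurable
        show "AE S in Q. AE g in R. hier_sparse k\<^sub>u k\<^sub>s (snd (\<Phi> (U, S, g)))"
          using AE_Q by eventually_elim (simp add: sparse elim)
      qed
    qed
  qed
  then show "AE p in (signal_law k\<^sub>u k\<^sub>s :: ('u set \<times> ('u, 's) signal) measure). hier_sparse k\<^sub>u k\<^sub>s (snd p)"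
    unfolding law by (subst AE_distr_iff[OF \<Phi> hier])

  assume "0 \<le> t"
  have [measurable]: "Measurable.pred (count_space UNIV \<Otimes>\<^sub>M borel) (\<lambda>p :: 'u set \<times> ('u, 's) signal. i \<in> fst p)"
    by (rule measurable_compose[OF measurable_fst]) simp
  define E where "E = {p :: 'u set \<times> ('u, 's) signal. i \<in> fst p \<and> (norm (block (snd p) i))\<^sup>2 \<le> t}"
  have E [measurable]: "E \<in> sets (count_space UNIV \<Otimes>\<^sub>M borel)"
  proof -
    have "{p \<in> space (count_space UNIV \<Otimes>\<^sub>M borel). i \<in> fst p \<and> (norm (block (snd p) i))\<^sup>2 \<le> t}
        \<in> sets (count_space UNIV \<Otimes>\<^sub>M (borel :: ('u, 's) signal measure))"
      by measurable
    then show ?thesis by (simp add: E_def space_pair_measure)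
  qed
  have act: "{p :: 'u set \<times> ('u, 's) signal. i \<in> fst p} \<in> sets (count_space UNIV \<Otimes>\<^sub>M borel)"
  proof -
    have "{p \<in> space (count_space UNIV \<Otimes>\<^sub>M borel). i \<in> fst p}
        \<in> sets (count_space UNIV \<Otimes>\<^sub>M (borel :: ('u, 's) signal measure))"
      by measurable
    then show ?thesis by (simp add: space_pair_measure)
  qed
  \<comment> \<open>Only the Gaussian values are integrated here. For an inactive user both sides
    are zero; for an active one the block is supported in the fixed set \<open>S i\<close>.\<close>
  have inner: "(\<integral>\<^sup>+g. indicator E (\<Phi> (U, S, g)) \<partial>R) \<le> indicator {U. i \<in> U} U * ennreal (t ^ k\<^sub>s / fact k\<^sub>s)"
    if S: "card (S i) = k\<^sub>s" for U S
  proof (cases "i \<in> U")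
    case True
    have ne: "{i} \<times> S i \<noteq> {}" using S assms by auto
    \<comment> \<open>The Erlang index \<open>k\<^sub>s - 1\<close> turns back into the exponent
      \<open>k\<^sub>s\<close> in \<open>erlang_CDF_le\<close>, because \<open>k\<^sub>s\<close> is
      positive.\<close>
    have card: "card ({i} \<times> S i) - 1 = k\<^sub>s - 1" using S by simp
    have energy: "(norm (block (snd (\<Phi> (U, S, g))) i))\<^sup>2 = (\<Sum>p\<in>{i} \<times> S i. (cmod (g $ p))\<^sup>2)" for g
    proof -
      have "(norm (block (snd (\<Phi> (U, S, g))) i))\<^sup>2 = (\<Sum>j\<in>S i. (cmod (g $ (i, j)))\<^sup>2)"
        unfolding power2_norm_block using True
        by (intro sum.mono_neutral_cong_right) (auto simp: \<Phi>_def)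
      also have "\<dots> = (\<Sum>p\<in>{i} \<times> S i. (cmod (g $ p))\<^sup>2)"
        by (intro sum.reindex_bij_witness[of _ snd "Pair i"]) auto
      finally show ?thesis .
    qed
    have "(\<integral>\<^sup>+g. indicator E (\<Phi> (U, S, g)) \<partial>R)
        = (\<integral>\<^sup>+g. indicator {g. (\<Sum>p\<in>{i} \<times> S i. (cmod (g $ p))\<^sup>2) \<le> t} g \<partial>R)"
      using True energy by (intro nn_integral_cong) (auto simp: E_def \<Phi>_def split: split_indicator)
    also have "\<dots> = emeasure R {g \<in> space R. (\<Sum>p\<in>{i} \<times> S i. (cmod (g $ p))\<^sup>2) \<le> t}"
      by (subst nn_integral_indicator[symmetric]) (simp_all add: space R_def)
    also have "\<dots> = ennreal (erlang_CDF (k\<^sub>s - 1) 1 t)"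
      using R.erlang_distributed_le[OF distributed_sum_cmod_power2[of 1 "{i} \<times> S i", folded R_def, unfolded card], of t]
        ne \<open>0 \<le> t\<close> by (simp add: R.emeasure_eq_measure)
    also have "\<dots> \<le> ennreal (t ^ k\<^sub>s / fact k\<^sub>s)"
      using erlang_CDF_le[OF \<open>0 \<le> t\<close>, of "k\<^sub>s - 1"] assms by (intro ennreal_leI) simp
    finally show ?thesis using True by simp
  next
    case False
    then show ?thesis by (simp add: E_def \<Phi>_def)
  qed
  have [measurable]: "{U. i \<in> U} \<in> sets P"
    by (simp add: P_def)
  have "emeasure (signal_law k\<^sub>u k\<^sub>s) E = (\<integral>\<^sup>+p. indicator E p \<partial>distr (P \<Otimes>\<^sub>M Q \<Otimes>\<^sub>M R) (count_space UNIV \<Otimes>\<^sub>M borel) \<Phi>)"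
    unfolding law by (simp add: E)
  also have "\<dots> = (\<integral>\<^sup>+w. indicator E (\<Phi> w) \<partial>(P \<Otimes>\<^sub>M Q \<Otimes>\<^sub>M R))"
    by (rule nn_integral_distr) measurable
  also have "\<dots> = (\<integral>\<^sup>+U. \<integral>\<^sup>+w. indicator E (\<Phi> (U, w)) \<partial>(Q \<Otimes>\<^sub>M R) \<partial>P)"
    by (rule QR.P.nn_integral_fst[symmetric]) measurable
  also have "\<dots> = (\<integral>\<^sup>+U. \<integral>\<^sup>+S. \<integral>\<^sup>+g. indicator E (\<Phi> (U, S, g)) \<partial>R \<partial>Q \<partial>P)"
  proof (intro nn_integral_cong)
    fix U assume "U \<in> space P"
    then have [measurable]: "(\<lambda>w. \<Phi> (U, w)) \<in> Q \<Otimes>\<^sub>M R \<rightarrow>\<^sub>M count_space UNIV \<Otimes>\<^sub>M borel"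
      by (rule measurable_Pair2[OF \<Phi>])
    show "(\<integral>\<^sup>+w. indicator E (\<Phi> (U, w)) \<partial>(Q \<Otimes>\<^sub>M R)) = (\<integral>\<^sup>+S. \<integral>\<^sup>+g. indicator E (\<Phi> (U, S, g)) \<partial>R \<partial>Q)"
      by (rule R.nn_integral_fst[symmetric]) measurable
  qed
  \<comment> \<open>\<open>inner\<close> is available only for position sets of the right size,
    hence the almost-everywhere monotonicity in \<open>S\<close>.\<close>
  also have "\<dots> \<le> (\<integral>\<^sup>+U. \<integral>\<^sup>+S. indicator {U. i \<in> U} U * ennreal (t ^ k\<^sub>s / fact k\<^sub>s) \<partial>Q \<partial>P)"
    using AE_Q by (intro nn_integral_mono nn_integral_mono_AE) (auto elim!: eventually_mono intro!: inner)
  also have "\<dots> = emeasure P {U. i \<in> U} * ennreal (t ^ k\<^sub>s / fact k\<^sub>s)"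
    by (simp add: Q.emeasure_space_1 nn_integral_multc)
  also have "emeasure P {U. i \<in> U} = emeasure (signal_law k\<^sub>u k\<^sub>s) {p :: 'u set \<times> ('u, 's) signal. i \<in> fst p}"
  proof -
    have "emeasure (signal_law k\<^sub>u k\<^sub>s) {p :: 'u set \<times> ('u, 's) signal. i \<in> fst p}
        = emeasure (P \<Otimes>\<^sub>M Q \<Otimes>\<^sub>M R) ({U. i \<in> U} \<times> space (Q \<Otimes>\<^sub>M R))"
      unfolding law
      by (subst emeasure_distr[OF \<Phi> act]) (auto simp: \<Phi>_def space_pair_measure space intro!: arg_cong2[where f=emeasure])
    also have "\<dots> = emeasure P {U. i \<in> U}"
      by (subst QR.P.emeasure_pair_measure_Times) (auto simp: QR.P.emeasure_space_1)
    finally show ?thesis ..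
  qed
  finally show "emeasure (signal_law k\<^sub>u k\<^sub>s) {p :: 'u set \<times> ('u, 's) signal. i \<in> fst p \<and> (norm (block (snd p) i))\<^sup>2 \<le> t}
        \<le> emeasure (signal_law k\<^sub>u k\<^sub>s) {p :: 'u set \<times> ('u, 's) signal. i \<in> fst p} * ennreal (t ^ k\<^sub>s / fact k\<^sub>s)"
    unfolding E_def .
qed

section \<open>Noise moments and consequences of independence\<close>

lemma nn_integral_complex_normal_vec_norm_power:
  assumes "0 < v"
  shows "(\<integral>\<^sup>+w. ennreal ((norm w)\<^sup>2 ^ k) \<partial>(complex_normal_vec v :: (complex ^ 'm::finite) measure))
    = ennreal (v ^ k * fact (CARD('m) - 1 + k) / fact (CARD('m) - 1))"
proof -
  interpret R: prob_space "complex_normal_vec v :: (complex ^ 'm) measure"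
    using assms by (rule prob_space_complex_normal_vec)
  \<comment> \<open>The squared norm sums over all coordinates, so
    \<open>distributed_sum_cmod_power2\<close> is applied with the full index set; its moments are
    the known Erlang moments.\<close>
  have D: "distributed (complex_normal_vec v :: (complex ^ 'm) measure) lborel (\<lambda>w. (norm w)\<^sup>2)
      (erlang_density (CARD('m) - 1) (1 / v))"
    unfolding power2_norm_vec using assms by (intro distributed_sum_cmod_power2) auto
  have "(\<integral>\<^sup>+w. ennreal ((norm w)\<^sup>2 ^ k) \<partial>(complex_normal_vec v :: (complex ^ 'm) measure))
      = ennreal (R.expectation (\<lambda>w. (norm w)\<^sup>2 ^ k))"
    using R.erlang_ith_moment_integrable[OF _ D] assms by (intro nn_integral_eq_integral) auto
  also have "R.expectation (\<lambda>w. (norm w)\<^sup>2 ^ k) = v ^ k * fact (CARD('m) - 1 + k) / fact (CARD('m) - 1)"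
    using R.erlang_ith_moment[OF _ D, of k] assms by (simp add: power_one_over)
  finally show ?thesis .
qed

text \<open>A product of sigma-finite measures is determined by its values on rectangles.
  Independence enters as factorisation over preimages, which allows \<open>X\<close> and
  \<open>Z\<close> to take values in different types.\<close>

lemma (in prob_space) distr_Pair_eqI:
  assumes X [measurable]: "X \<in> M \<rightarrow>\<^sub>M N\<^sub>1" and Z [measurable]: "Z \<in> M \<rightarrow>\<^sub>M N\<^sub>2"
    and "\<And>a b. a \<in> sets N\<^sub>1 \<Longrightarrow> b \<in> sets N\<^sub>2 \<Longrightarrow>
      prob ((X -` a \<inter> space M) \<inter> (Z -` b \<inter> space M)) = prob (X -` a \<inter> space M) * prob (Z -` b \<inter> space M)"
  shows "distr M (N\<^sub>1 \<Otimes>\<^sub>M N\<^sub>2) (\<lambda>\<omega>. (X \<omega>, Z \<omega>)) = distr M N\<^sub>1 X \<Otimes>\<^sub>M distr M N\<^sub>2 Z"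
proof (rule pair_measure_eqI[symmetric])
  show "sigma_finite_measure (distr M N\<^sub>1 X)" "sigma_finite_measure (distr M N\<^sub>2 Z)"
    by (intro prob_space_imp_sigma_finite prob_space_distr X Z)+
  show "sets (distr M N\<^sub>1 X \<Otimes>\<^sub>M distr M N\<^sub>2 Z) = sets (distr M (N\<^sub>1 \<Otimes>\<^sub>M N\<^sub>2) (\<lambda>\<omega>. (X \<omega>, Z \<omega>)))"
    by (simp cong: sets_pair_measure_cong)
  fix a b assume "a \<in> sets (distr M N\<^sub>1 X)" "b \<in> sets (distr M N\<^sub>2 Z)"
  then have ab [measurable]: "a \<in> sets N\<^sub>1" "b \<in> sets N\<^sub>2" by simp_all
  have "emeasure (distr M (N\<^sub>1 \<Otimes>\<^sub>M N\<^sub>2) (\<lambda>\<omega>. (X \<omega>, Z \<omega>))) (a \<times> b)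
      = emeasure M ((X -` a \<inter> space M) \<inter> (Z -` b \<inter> space M))"
    by (subst emeasure_distr) (auto intro!: arg_cong2[where f=emeasure])
  then show "emeasure (distr M N\<^sub>1 X) a * emeasure (distr M N\<^sub>2 Z) b
      = emeasure (distr M (N\<^sub>1 \<Otimes>\<^sub>M N\<^sub>2) (\<lambda>\<omega>. (X \<omega>, Z \<omega>))) (a \<times> b)"
    using assms(3)[OF ab] by (simp add: emeasure_distr emeasure_eq_measure ennreal_mult)
qed

text \<open>The two pairs extracted are, in the application, signal against matrix (for the isometry
  failure) and signal against noise (for the joint law).\<close>

lemma (in prob_space) indep_threeD:
  assumes "indep_three M N\<^sub>1 X N\<^sub>2 Y N\<^sub>3 Z"
  shows "a \<in> sets N\<^sub>1 \<Longrightarrow> b \<in> sets N\<^sub>2 \<Longrightarrow>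
      prob ((X -` a \<inter> space M) \<inter> (Y -` b \<inter> space M)) = prob (X -` a \<inter> space M) * prob (Y -` b \<inter> space M)"
    and "a \<in> sets N\<^sub>1 \<Longrightarrow> c \<in> sets N\<^sub>3 \<Longrightarrow>
      prob ((X -` a \<inter> space M) \<inter> (Z -` c \<inter> space M)) = prob (X -` a \<inter> space M) * prob (Z -` c \<inter> space M)"
proof -
  note indep = assms[unfolded indep_three_def]
  show "prob ((X -` a \<inter> space M) \<inter> (Y -` b \<inter> space M)) = prob (X -` a \<inter> space M) * prob (Y -` b \<inter> space M)"
    if "a \<in> sets N\<^sub>1" "b \<in> sets N\<^sub>2"
    using indep_setsD[OF indep, of "{0, 1}" "\<lambda>k. if k = 0 then X -` a \<inter> space M else Y -` b \<inter> space M"] that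
    by (simp add: in_vimage_algebra) (metis Int_commute)
  show "prob ((X -` a \<inter> space M) \<inter> (Z -` c \<inter> space M)) = prob (X -` a \<inter> space M) * prob (Z -` c \<inter> space M)"
    if "a \<in> sets N\<^sub>1" "c \<in> sets N\<^sub>3"
    using indep_setsD[OF indep, of "{0, 2}" "\<lambda>k. if k = 0 then X -` a \<inter> space M else Z -` c \<inter> space M"] that
    by (simp add: in_vimage_algebra) (metis Int_commute)
qed

section \<open>The bound on missed detection\<close>

theorem theorem2:
  fixes M :: "'a measure"
    and act :: "'a \<Rightarrow> 'u::finite set"
    and h :: "'a \<Rightarrow> ('u, 's::finite) signal"
    and A :: "'a \<Rightarrow> ('u, 's, 'm::finite) measurement_matrix"
    and z y :: "'a \<Rightarrow> complex ^ 'm"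
    and alg :: "('u, 's, 'm) measurement_matrix \<Rightarrow> complex ^ 'm \<Rightarrow> ('u, 's) signal"
    and hstar :: "'a \<Rightarrow> ('u, 's) signal"
    and step :: "('u, 's, 'm) measurement_matrix \<Rightarrow> complex ^ 'm
          \<Rightarrow> ('u, 's) signal \<Rightarrow> ('u, 's) signal \<Rightarrow> bool"
    and stop :: "('u, 's, 'm) measurement_matrix \<Rightarrow> complex ^ 'm \<Rightarrow> ('u, 's) signal list \<Rightarrow> bool"
    and k\<^sub>u k\<^sub>s n p q :: nat
    and \<sigma> \<tau> \<delta> \<xi> :: real
    and i :: 'u
  assumes "prob_space M"
    and "0 < k\<^sub>u" "k\<^sub>u \<le> CARD('u)" "0 < k\<^sub>s" "k\<^sub>s \<le> CARD('s)"
    and "CARD('u) * CARD('s) \<le> n" "CARD('m) \<le> n"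
    and "\<sigma> > 0" "\<xi> \<ge> 0"
    \<comment> \<open>signal, matrix and noise\<close>
    and "(\<lambda>\<omega>. (act \<omega>, h \<omega>)) \<in> M \<rightarrow>\<^sub>M count_space UNIV \<Otimes>\<^sub>M borel"
    and "distr M (count_space UNIV \<Otimes>\<^sub>M borel) (\<lambda>\<omega>. (act \<omega>, h \<omega>)) = signal_law k\<^sub>u k\<^sub>s"
    and "A \<in> borel_measurable M"
    and "z \<in> borel_measurable M"
    and "distr M borel z = complex_normal_vec (\<sigma>\<^sup>2 / real n)"
    and "indep_three M (count_space UNIV \<Otimes>\<^sub>M borel) (\<lambda>\<omega>. (act \<omega>, h \<omega>)) borel A borel z"
    and "\<And>\<omega>. y \<omega> = A \<omega> *v h \<omega> + z \<omega>"
    \<comment> \<open>output of the algorithm\<close>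
    and "step = HiHTP_step k\<^sub>u k\<^sub>s \<or> step = HiIHT_step k\<^sub>u k\<^sub>s"
    and "\<And>B v. algorithm_output step stop B v (alg B v)"
    and "\<And>\<omega>. hstar \<omega> = alg (A \<omega>) (y \<omega>)"
    and "hstar \<in> borel_measurable M"
    \<comment> \<open>recovery guarantee\<close>
    and "AE \<omega> in M. has_HiRIP p q \<delta> (A \<omega>) \<longrightarrow> hier_sparse k\<^sub>u k\<^sub>s (h \<omega>) \<longrightarrow>
            norm (hstar \<omega> - h \<omega>) \<le> \<tau> * norm (z \<omega>)"
  shows "P_md M act hstar i \<xi>
    \<le> measure M {\<omega> \<in> space M. \<not> has_HiRIP p q \<delta> (A \<omega>)}
      + energy_cdf M act h i (4 * \<xi>)
      + (4 * \<tau>\<^sup>2) ^ k\<^sub>s * real n powi (- int k\<^sub>s) * SNR \<sigma> powi (- int k\<^sub>s) * B\<^sub>1 CARD('m) k\<^sub>s"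
proof -
  interpret prob_space M by fact
  note [measurable] = \<open>A \<in> borel_measurable M\<close> \<open>z \<in> borel_measurable M\<close>
    \<open>(\<lambda>\<omega>. (act \<omega>, h \<omega>)) \<in> M \<rightarrow>\<^sub>M count_space UNIV \<Otimes>\<^sub>M borel\<close>
  note law = \<open>distr M (count_space UNIV \<Otimes>\<^sub>M borel) (\<lambda>\<omega>. (act \<omega>, h \<omega>)) = signal_law k\<^sub>u k\<^sub>s\<close>
  note indep = \<open>indep_three M (count_space UNIV \<Otimes>\<^sub>M borel) (\<lambda>\<omega>. (act \<omega>, h \<omega>)) borel A borel z\<close>
  note sparsity = \<open>0 < k\<^sub>u\<close> \<open>k\<^sub>u \<le> CARD('u)\<close> \<open>0 < k\<^sub>s\<close> \<open>k\<^sub>s \<le> CARD('s)\<close>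
  have "0 < n"
    using \<open>CARD('m) \<le> n\<close> by (rule less_le_trans[rotated]) simp
  define v where "v = \<sigma>\<^sup>2 / real n"
  have "0 < v" using \<open>0 < n\<close> \<open>\<sigma> > 0\<close> by (simp add: v_def)
  have z_law: "distr M borel z = complex_normal_vec v"
    unfolding v_def by fact

  have [measurable]: "h \<in> borel_measurable M"
    using measurable_compose[OF assms(10) measurable_snd] by simp
  have [measurable]: "Measurable.pred M (\<lambda>\<omega>. i \<in> act \<omega>)"
    using measurable_compose[OF measurable_compose[OF assms(10) measurable_fst], of "\<lambda>U. i \<in> U"] by simp

  \<comment> \<open>Apart from \<open>FAIL\<close>, all events include activity of user
    \<open>i\<close>, so that dividing by \<open>prob ACT\<close> yields conditional probabilities.
    The conjuncts of \<open>MISS\<close> and \<open>LOW\<close> are ordered as in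
    \<open>cond_prob\<close>, for the final unfolding.\<close>
  define ACT where "ACT = {\<omega> \<in> space M. i \<in> act \<omega>}"
  define MISS where "MISS = {\<omega> \<in> space M. \<not> declared_active \<xi> (hstar \<omega>) i \<and> i \<in> act \<omega>}"
  define FAIL where "FAIL = {\<omega> \<in> space M. \<not> has_HiRIP p q \<delta> (A \<omega>)}"
  define LOW where "LOW = {\<omega> \<in> space M. (norm (block (h \<omega>) i))\<^sup>2 \<le> 4 * \<xi> \<and> i \<in> act \<omega>}"
  define NOISE where "NOISE = {\<omega> \<in> space M. i \<in> act \<omega> \<and> (norm (block (h \<omega>) i))\<^sup>2 \<le> 4 * \<tau>\<^sup>2 * (norm (z \<omega>))\<^sup>2}"
  define b where "b = (4 * \<tau>\<^sup>2) ^ k\<^sub>s * v ^ k\<^sub>s * B\<^sub>1 CARD('m) k\<^sub>s"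
  have [measurable]: "ACT \<in> events" "FAIL \<in> events" "LOW \<in> events" "NOISE \<in> events"
    unfolding ACT_def FAIL_def LOW_def NOISE_def by measurable
  have B\<^sub>1: "B\<^sub>1 CARD('m) k\<^sub>s = fact (CARD('m) - 1 + k\<^sub>s) / (fact (CARD('m) - 1) * fact k\<^sub>s)"
    using \<open>0 < k\<^sub>s\<close> by (intro B\<^sub>1_eq) auto
  have "0 \<le> b"
    using \<open>0 < v\<close> by (simp add: b_def B\<^sub>1)

  have "AE \<omega> in M. hier_sparse k\<^sub>u k\<^sub>s (h \<omega>)"
    using AE_signal_law_hier_sparse[OF sparsity] AE_distrD[OF assms(10), of "\<lambda>p. hier_sparse k\<^sub>u k\<^sub>s (snd p)"]
    unfolding law by simp
  \<comment> \<open>By contraposition: outside the three events both \<open>sqrt \<xi>\<close> and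
    \<open>\<tau> * norm (z \<omega>)\<close> lie below half the norm of the true block, while a
    miss forces that norm below their sum.\<close>
  with assms(21) have "AE \<omega> in M. \<omega> \<in> MISS \<longrightarrow> \<omega> \<in> (FAIL \<inter> ACT) \<union> (LOW \<union> NOISE)"
  proof eventually_elim
    case (elim \<omega>)
    show ?case
    proof
      assume "\<omega> \<in> MISS"
      then have \<omega>: "\<omega> \<in> space M" "i \<in> act \<omega>" and miss: "norm (block (hstar \<omega>) i) < sqrt \<xi>"
        by (auto simp: MISS_def declared_active_def)
      show "\<omega> \<in> (FAIL \<inter> ACT) \<union> (LOW \<union> NOISE)"
      proof (rule ccontr)
        assume not: "\<omega> \<notin> (FAIL \<inter> ACT) \<union> (LOW \<union> NOISE)"
        then have "has_HiRIP p q \<delta> (A \<omega>)" and low: "4 * \<xi> < (norm (block (h \<omega>) i))\<^sup>2"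
          and noise: "4 * \<tau>\<^sup>2 * (norm (z \<omega>))\<^sup>2 < (norm (block (h \<omega>) i))\<^sup>2"
          using \<omega> by (auto simp: FAIL_def ACT_def LOW_def NOISE_def)
        then have rec: "norm (hstar \<omega> - h \<omega>) \<le> \<tau> * norm (z \<omega>)"
          using elim by simp
        have "norm (block (hstar \<omega>) i - block (h \<omega>) i) \<le> norm (hstar \<omega> - h \<omega>)"
        proof (rule power2_le_imp_le)
          have "(norm (block (hstar \<omega>) i - block (h \<omega>) i))\<^sup>2
              = (\<Sum>p\<in>{i} \<times> UNIV. (cmod ((hstar \<omega> - h \<omega>) $ p))\<^sup>2)"
            unfolding power2_norm_vec
            by (intro sum.reindex_bij_witness[of _ snd "Pair i"]) (auto simp: block_def)
          also have "\<dots> \<le> (norm (hstar \<omega> - h \<omega>))\<^sup>2"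
            unfolding power2_norm_vec by (intro sum_mono2) auto
          finally show "(norm (block (hstar \<omega>) i - block (h \<omega>) i))\<^sup>2 \<le> (norm (hstar \<omega> - h \<omega>))\<^sup>2" .
        qed simp
        with rec have "norm (block (h \<omega>) i) < sqrt \<xi> + \<tau> * norm (z \<omega>)"
          using miss norm_triangle_ineq2[of "block (h \<omega>) i" "block (hstar \<omega>) i"]
          by (simp add: norm_minus_commute)
        \<comment> \<open>Splitting the block norm into two equal halves is the origin of the
          factors 4 in \<open>4 * \<xi>\<close> and \<open>4 * \<tau>\<^sup>2\<close>.\<close>
        moreover have "2 * sqrt \<xi> < norm (block (h \<omega>) i)"
          by (rule power2_less_imp_less) (use low \<open>\<xi> \<ge> 0\<close> in \<open>auto simp: power_mult_distrib\<close>)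
        moreover have "2 * (\<tau> * norm (z \<omega>)) < norm (block (h \<omega>) i)"
          by (rule power2_less_imp_less) (use noise in \<open>auto simp: power_mult_distrib\<close>)
        ultimately show False by linarith
      qed
    qed
  qed
  then have "prob MISS \<le> prob ((FAIL \<inter> ACT) \<union> (LOW \<union> NOISE))"
    by (intro finite_measure_mono_AE) auto
  also have "\<dots> \<le> prob (FAIL \<inter> ACT) + (prob LOW + prob NOISE)"
    by (intro order_trans[OF measure_Un_le] add_left_mono measure_Un_le) auto
  \<comment> \<open>\<open>FAIL\<close> depends on the matrix and \<open>ACT\<close> on the signal.
    Independence lets the unconditional failure probability survive the division by
    \<open>prob ACT\<close>.\<close>
  also have "prob (FAIL \<inter> ACT) = prob FAIL * prob ACT"
  proof -
    have fail: "{B :: ('u, 's, 'm) measurement_matrix. \<not> has_HiRIP p q \<delta> B} \<in> sets borel"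
      by measurable
    have act: "{U :: 'u set. i \<in> U} \<times> (UNIV :: ('u, 's) signal set) \<in> sets (count_space UNIV \<Otimes>\<^sub>M borel)"
      by (intro pair_measureI) auto
    have "A -` {B. \<not> has_HiRIP p q \<delta> B} \<inter> space M = FAIL"
      "(\<lambda>\<omega>. (act \<omega>, h \<omega>)) -` ({U. i \<in> U} \<times> UNIV) \<inter> space M = ACT"
      by (auto simp: FAIL_def ACT_def)
    then show ?thesis
      using indep_threeD(1)[OF indep act fail] by (simp add: Int_commute mult.commute)
  qed
  \<comment> \<open>By independence the joint law of signal and noise is a product. With the noise
    integrated last, the threshold is deterministic in each section and the energy bound of the
    signal law applies.\<close>
  also have "prob NOISE \<le> prob ACT * b"
  proof -
    define L where "L = (signal_law k\<^sub>u k\<^sub>s :: ('u set \<times> ('u, 's) signal) measure)"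
    define R where "R = (complex_normal_vec v :: (complex ^ 'm) measure)"
    have setsL [measurable_cong]: "sets L = sets (count_space UNIV \<Otimes>\<^sub>M borel)"
      by (simp add: L_def signal_law_def)
    have setsR [measurable_cong]: "sets R = sets borel"
      by (simp add: R_def)
    have spaceL: "space L = UNIV"
      using sets_eq_imp_space_eq[OF setsL] by (simp add: space_pair_measure)
    have spaceR: "space R = UNIV" by (simp add: R_def)
    interpret L: prob_space L
      unfolding L_def law[symmetric] using assms(10) by (rule prob_space_distr)
    interpret R: prob_space R
      unfolding R_def using \<open>0 < v\<close> by (rule prob_space_complex_normal_vec)
    interpret LR: pair_prob_space L R ..
    have joint: "distr M ((count_space UNIV \<Otimes>\<^sub>M borel) \<Otimes>\<^sub>M borel) (\<lambda>\<omega>. ((act \<omega>, h \<omega>), z \<omega>)) = L \<Otimes>\<^sub>M R"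
      unfolding L_def R_def law[symmetric] z_law[symmetric]
      by (rule distr_Pair_eqI[OF assms(10) \<open>z \<in> borel_measurable M\<close>]) (rule indep_threeD(2)[OF indep])
    have [measurable]: "Measurable.pred (L \<Otimes>\<^sub>M R) (\<lambda>w. i \<in> fst (fst w))"
    proof -
      have "(\<lambda>w. fst (fst w)) \<in> L \<Otimes>\<^sub>M R \<rightarrow>\<^sub>M count_space UNIV" by measurable
      then show ?thesis by (rule measurable_compose) simp
    qed
    define E where "E = {w :: ('u set \<times> ('u, 's) signal) \<times> (complex ^ 'm).
      i \<in> fst (fst w) \<and> (norm (block (snd (fst w)) i))\<^sup>2 \<le> 4 * \<tau>\<^sup>2 * (norm (snd w))\<^sup>2}"
    have E: "E \<in> sets (L \<Otimes>\<^sub>M R)"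
    proof -
      have "{w \<in> space (L \<Otimes>\<^sub>M R). i \<in> fst (fst w) \<and> (norm (block (snd (fst w)) i))\<^sup>2 \<le> 4 * \<tau>\<^sup>2 * (norm (snd w))\<^sup>2}
          \<in> sets (L \<Otimes>\<^sub>M R)"
        by measurable
      then show ?thesis by (simp add: E_def space_pair_measure spaceL spaceR)
    qed
    have "emeasure M NOISE = emeasure (L \<Otimes>\<^sub>M R) E"
      using E unfolding joint[symmetric]
      by (subst emeasure_distr) (auto simp: E_def NOISE_def intro!: arg_cong2[where f=emeasure])
    also have "\<dots> = (\<integral>\<^sup>+w. emeasure L ((\<lambda>p. (p, w)) -` E) \<partial>R)"
      using E by (rule LR.emeasure_pair_measure_alt2)
    also have "\<dots> \<le> (\<integral>\<^sup>+w. emeasure L {p. i \<in> fst p} * ennreal ((4 * \<tau>\<^sup>2) ^ k\<^sub>s / fact k\<^sub>s) * ennreal ((norm w)\<^sup>2 ^ k\<^sub>s) \<partial>R)"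
    proof (rule nn_integral_mono)
      fix w
      have "emeasure L ((\<lambda>p. (p, w)) -` E)
          = emeasure L {p. i \<in> fst p \<and> (norm (block (snd p) i))\<^sup>2 \<le> 4 * \<tau>\<^sup>2 * (norm w)\<^sup>2}"
        by (auto simp: E_def intro!: arg_cong2[where f=emeasure])
      also have "\<dots> \<le> emeasure L {p. i \<in> fst p} * ennreal ((4 * \<tau>\<^sup>2 * (norm w)\<^sup>2) ^ k\<^sub>s / fact k\<^sub>s)"
        unfolding L_def by (rule signal_law_block_energy_le[OF sparsity]) simp
      also have "ennreal ((4 * \<tau>\<^sup>2 * (norm w)\<^sup>2) ^ k\<^sub>s / fact k\<^sub>s)
          = ennreal ((4 * \<tau>\<^sup>2) ^ k\<^sub>s / fact k\<^sub>s) * ennreal ((norm w)\<^sup>2 ^ k\<^sub>s)"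
        by (simp add: power_mult_distrib mult.assoc ennreal_mult[symmetric])
      finally show "emeasure L ((\<lambda>p. (p, w)) -` E)
          \<le> emeasure L {p. i \<in> fst p} * ennreal ((4 * \<tau>\<^sup>2) ^ k\<^sub>s / fact k\<^sub>s) * ennreal ((norm w)\<^sup>2 ^ k\<^sub>s)"
        by (simp add: mult.assoc)
    qed
    also have "\<dots> = emeasure L {p. i \<in> fst p} * ennreal ((4 * \<tau>\<^sup>2) ^ k\<^sub>s / fact k\<^sub>s)
        * ennreal (v ^ k\<^sub>s * fact (CARD('m) - 1 + k\<^sub>s) / fact (CARD('m) - 1))"
      using nn_integral_complex_normal_vec_norm_power[OF \<open>0 < v\<close>, of k\<^sub>s, where 'm='m]
      by (subst nn_integral_cmult) (simp_all add: R_def)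
    \<comment> \<open>The noise moment divided by \<open>fact k\<^sub>s\<close> is
      \<open>v ^ k\<^sub>s\<close> times the closed form of \<open>B\<^sub>1\<close>.\<close>
    also have "\<dots> = emeasure L {p. i \<in> fst p} * ennreal b"
      using \<open>0 < v\<close> by (simp add: b_def B\<^sub>1 ennreal_mult[symmetric] mult.assoc mult_ac)
    also have "emeasure L {p. i \<in> fst p} = emeasure M ACT"
    proof -
      have "{p :: 'u set \<times> ('u, 's) signal. i \<in> fst p} = {U. i \<in> U} \<times> UNIV" by auto
      also have "\<dots> \<in> sets (count_space UNIV \<Otimes>\<^sub>M borel)"
        by (intro pair_measureI) auto
      finally show ?thesis
        unfolding L_def law[symmetric]
        by (subst emeasure_distr) (auto simp: ACT_def intro!: arg_cong2[where f=emeasure])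
    qed
    finally show ?thesis
      using \<open>0 \<le> b\<close> by (simp add: emeasure_eq_measure ennreal_mult[symmetric])
  qed
  finally have main: "prob MISS \<le> prob FAIL * prob ACT + (prob LOW + prob ACT * b)"
    by simp

  \<comment> \<open>The noise variance \<open>v\<close> per coordinate is the reciprocal of
    \<open>real n * SNR \<sigma>\<close>, which explains the negative exponents.\<close>
  have b_eq: "(4 * \<tau>\<^sup>2) ^ k\<^sub>s * real n powi (- int k\<^sub>s) * SNR \<sigma> powi (- int k\<^sub>s) * B\<^sub>1 CARD('m) k\<^sub>s = b"
    by (simp add: b_def v_def SNR_def power_int_minus power_mult_distrib power_inverse divide_inverse)
  \<comment> \<open>In the case of a null event \<open>ACT\<close> both quotients are 0 by the
    convention for division by zero, and the other terms are nonnegative.\<close>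
  have "prob MISS / prob ACT \<le> prob FAIL + prob LOW / prob ACT + b"
  proof (cases "prob ACT = 0")
    case True
    then show ?thesis using \<open>0 \<le> b\<close> by simp
  next
    case False
    then have "0 < prob ACT" by (simp add: zero_less_measure_iff)
    then show ?thesis using main by (simp add: field_simps)
  qed
  then show ?thesis
    unfolding b_eq P_md_def energy_cdf_def cond_prob_def MISS_def ACT_def FAIL_def LOW_def .
qed

end
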